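(* Let $x,y \in \mathbb{R}^2$ be such that $|x-y|=(2\sqrt{2}/3)^k \cdot (\sqrt{3})^l$ for some non-negative integers $k,l$. Then there exists a finite set $S_{xy}$ with $\{x,y\} \subseteq S_{xy} \subseteq \mathbb{R}^2$ such that each unit-distance preserving mapping $f: S_{xy} \to \mathbb{C}^2$ preserves the distance between $x$ and $y$, i.e. satisfies $\varphi_2(f(x),f(y))=|x-y|^2$.
   Context: $|\cdot|$ is the Euclidean norm on $\mathbb{R}^2$. The map $\varphi_2:\mathbb{C}^2\times\mathbb{C}^2\to\mathbb{C}$ is $\varphi_2((x_1,x_2),(y_1,y_2))=(x_1-y_1)^2+(x_2-y_2)^2$ (no complex conjugation). For $S\subseteq\mathbb{R}^2$, a map $f:S\to\mathbb{C}^2$ is unit-distance preserving if for all $u,v\in S$, $|u-v|=1$ implies $\varphi_2(f(u),f(v))=1$. *)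

theory Defs
  imports "HOL-Analysis.Analysis"
begin

text \<open>There is no complex conjugation, so this is not the square of
  \<^term>\<open>dist\<close> on \<^typ>\<open>complex ^ 2\<close>.\<close>

definition phi2 :: "complex ^ 2 \<Rightarrow> complex ^ 2 \<Rightarrow> complex" where
  "phi2 x y = (x $ 1 - y $ 1)^2 + (x $ 2 - y $ 2)^2"

text \<open>A map from \<open>S\<close> to \<^typ>\<open>complex ^ 2\<close> is represented by a total function of which only the values
  on \<open>S\<close> matter.\<close>

definition unit_distance_preserving_on :: "(real ^ 2) set \<Rightarrow> (real ^ 2 \<Rightarrow> complex ^ 2) \<Rightarrow> bool" where
  "unit_distance_preserving_on S f \<longleftrightarrow>
     (\<forall>u\<in>S. \<forall>v\<in>S. norm (u - v) = 1 \<longrightarrow> phi2 (f u) (f v) = 1)"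

end

theory Submission
  imports Defs
begin

text \<open>Rhombi made of two equilateral triangles are sent to rhombi, because the only alternative,
  identifying the two far vertices, is excluded by the Moser spindle. Hence \<open>f\<close> respects the
  triangular lattice, in particular collinear equidistant points, at every scale at which distances
  are preserved. This yields the factor \<open>sqrt 3\<close>, the long diagonal of a rhombus, and the factor \<open>3\<close>.
  The median of the triangle with sides \<open>3, 3, 2\<close> has length \<open>sqrt 8\<close>, and the parallelogram law
  forces this length to be preserved as well. Finally a homothety of ratio \<open>1/3\<close>, realised by two
  rigid rods with a common end, gives the factor \<open>sqrt 8 / 3\<close>.\<close>

subsection \<open>Finitely enforced properties of unit-distance preserving maps\<close>

text \<open>A property holds eventually for this filter iff unit-distance preservation
  on some finite set enforces it.\<close>

definition udp_filter :: "(real ^ 2 \<Rightarrow> complex ^ 2) filter" where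
  "udp_filter = (INF S\<in>Collect finite. principal {f. unit_distance_preserving_on S f})"

lemma unit_distance_preserving_on_mono:
  "S \<subseteq> T \<Longrightarrow> unit_distance_preserving_on T f \<Longrightarrow> unit_distance_preserving_on S f"
  unfolding unit_distance_preserving_on_def by blast

text \<open>The union of two finite sets enforces whatever either one enforces, so the principal
  filters form a base. Combining enforced facts thus becomes conjunction under the filter.\<close>

lemma eventually_udp_filter:
  "eventually P udp_filter \<longleftrightarrow>
    (\<exists>S. finite S \<and> (\<forall>f. unit_distance_preserving_on S f \<longrightarrow> P f))"
proof -
  have "eventually P udp_filter \<longleftrightarrow>
     (\<exists>S\<in>Collect finite. eventually P (principal {f. unit_distance_preserving_on S f}))"
    unfolding udp_filter_def
  proof (rule eventually_INF_base)
    show "\<exists>U\<in>Collect finite. principal {f. unit_distance_preserving_on U f} \<le>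
        inf (principal {f. unit_distance_preserving_on S f}) (principal {f. unit_distance_preserving_on T f})"
      if "S \<in> Collect finite" "T \<in> Collect finite" for S T :: "(real ^ 2) set"
      using that
      by (intro bexI[of _ "S \<union> T"]) (auto intro: unit_distance_preserving_on_mono[rotated])
  qed auto
  then show ?thesis
    by (simp add: eventually_principal)
qed

text \<open>The finite set may depend on the pair. Positivity keeps \<open>d^2\<close> nonzero,
  which excludes degenerate images.\<close>

definition enforced_distance :: "real \<Rightarrow> bool" where
  "enforced_distance d \<longleftrightarrow> d > 0 \<and>
     (\<forall>x y. norm (x - y) = d \<longrightarrow> (\<forall>\<^sub>F f in udp_filter. phi2 (f x) (f y) = complex_of_real (d^2)))"

lemma enforced_distance_pos: "enforced_distance d \<Longrightarrow> d > 0"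
  by (simp add: enforced_distance_def)

lemma enforced_distanceD:
  "enforced_distance d \<Longrightarrow> norm (x - y) = d \<Longrightarrow>
    \<forall>\<^sub>F f in udp_filter. phi2 (f x) (f y) = complex_of_real (d^2)"
  by (simp add: enforced_distance_def)

lemma enforced_distance_1: "enforced_distance 1"
  unfolding enforced_distance_def eventually_udp_filter
proof (intro conjI allI impI)
  fix x y :: "real ^ 2"
  assume "norm (x - y) = 1"
  then show "\<exists>S. finite S \<and>
      (\<forall>f. unit_distance_preserving_on S f \<longrightarrow> phi2 (f x) (f y) = complex_of_real (1\<^sup>2))"
    by (intro exI[of _ "{x, y}"]) (simp add: unit_distance_preserving_on_def)
qed simp

subsection \<open>Similarities of the plane\<close>

text \<open>Multiplication by \<open>a + b i\<close> under the usual identification of the plane with the complex numbers.\<close>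

definition rot_scale :: "real \<Rightarrow> real \<Rightarrow> real ^ 2 \<Rightarrow> real ^ 2" where
  "rot_scale a b v = vector [a * v$1 - b * v$2, a * v$2 + b * v$1]"

lemma rot_scale_nth [simp]:
  "rot_scale a b v $ 1 = a * v$1 - b * v$2" "rot_scale a b v $ 2 = a * v$2 + b * v$1"
  by (simp_all add: rot_scale_def)

lemma norm_vec2: "norm (v :: real ^ 2) = sqrt ((v$1)^2 + (v$2)^2)"
  by (simp add: norm_vec_def L2_set_def sum_2)

lemma norm_rot_scale: "norm (rot_scale a b v) = sqrt (a^2 + b^2) * norm v"
proof -
  have "(a * v$1 - b * v$2)^2 + (a * v$2 + b * v$1)^2 = (a^2 + b^2) * ((v$1)^2 + (v$2)^2)"
    by algebra
  then show ?thesis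
    by (simp add: norm_vec2 real_sqrt_mult)
qed

text \<open>Reduces each length computation below to a coordinate identity and the value of
  \<open>a^2 + b^2\<close>.\<close>

lemma norm_eq_rot_scale:
  assumes "u = rot_scale a b v" "a^2 + b^2 = c^2" "c \<ge> 0"
  shows "norm u = c * norm v"
  using assms by (simp add: norm_rot_scale)

lemma vec2_eq_iff: "(u :: 'a ^ 2) = v \<longleftrightarrow> u$1 = v$1 \<and> u$2 = v$2"
  by (simp add: vec_eq_iff forall_2)

subsection \<open>Equilateral rhombi\<close>

text \<open>Both \<open>p - q\<close> and \<open>p + q - b - c\<close> are orthogonal to the non-isotropic vector \<open>c - b\<close> and
  to each other, so in dimension two one of them vanishes.\<close>

lemma phi2_two_circles:
  assumes "phi2 p b = r" "phi2 p c = r" "phi2 q b = r" "phi2 q c = r"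
    and "phi2 b c \<noteq> 0"
  shows "q = p \<or> q = b + c - p"
proof -
  define x y where "x = c$1 - b$1" and "y = c$2 - b$2"
  define g1 g2 where "g1 = p$1 - q$1" and "g2 = p$2 - q$2"
  define w1 w2 where "w1 = p$1 + q$1 - b$1 - c$1" and "w2 = p$2 + q$2 - b$2 - c$2"
  note defs = x_def y_def g1_def g2_def w1_def w2_def
  have d: "x^2 + y^2 \<noteq> 0"
    using assms(5) by (simp add: phi2_def defs power2_commute)
  have "2 * (g1 * x + g2 * y) = phi2 p b - phi2 p c - phi2 q b + phi2 q c"
    "2 * (w1 * x + w2 * y) = phi2 p b - phi2 p c + phi2 q b - phi2 q c"
    "2 * (g1 * w1 + g2 * w2) = phi2 p b + phi2 p c - phi2 q b - phi2 q c"
    unfolding phi2_def defs by (simp_all add: power2_eq_square algebra_simps)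
  then have g: "g1 * x + g2 * y = 0" and w: "w1 * x + w2 * y = 0" and gw: "g1 * w1 + g2 * w2 = 0"
    using assms(1-4) by (simp_all del: distrib_left_numeral)
  have "(g1 * y - g2 * x) * (w1 * y - w2 * x) = (g1 * w1 + g2 * w2) * (x^2 + y^2)
      - (g1 * x + g2 * y) * (w1 * x + w2 * y)"
    by algebra
  then have "(g1 * y - g2 * x) * (w1 * y - w2 * x) = 0"
    using g gw by simp
  then consider "g1 * y - g2 * x = 0" | "w1 * y - w2 * x = 0"
    by auto
  then show ?thesis
  proof cases
    case 1
    then have "g1 * (x^2 + y^2) = 0" "g2 * (x^2 + y^2) = 0"
      using g by algebra+
    then show ?thesis
      using d by (simp add: vec2_eq_iff defs)
  next
    case 2
    then have "w1 * (x^2 + y^2) = 0" "w2 * (x^2 + y^2) = 0"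
      using w by algebra+
    then have "w1 = 0" "w2 = 0"
      using d by simp_all
    then show ?thesis
      by (simp add: vec2_eq_iff defs algebra_simps)
  qed
qed

text \<open>The parallelogram law, valid for any symmetric bilinear form. With sides and short
  diagonal equal it gives the factor 2 + 2 - 1 = 3.\<close>

lemma phi2_rhombus:
  "phi2 p (b + c - p) = 2 * phi2 p b + 2 * phi2 p c - phi2 b c"
  unfolding phi2_def by (simp add: power2_eq_square algebra_simps)

lemma eventually_rhombus_cases:
  assumes d: "enforced_distance d"
    and "norm (a - b) = d" "norm (a - c) = d" "norm (b - c) = d"
  shows "\<forall>\<^sub>F f in udp_filter.
    f (b + c - a) = f a \<or>
    f (b + c - a) = f b + f c - f a \<and> phi2 (f a) (f (b + c - a)) = 3 * complex_of_real (d^2)"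
proof -
  have "norm (b + c - a - b) = d" "norm (b + c - a - c) = d"
    using assms(2,3) by (simp_all add: norm_minus_commute)
  note E = enforced_distanceD[OF d]
  show ?thesis
    using E[OF assms(2)] E[OF assms(3)] E[OF assms(4)]
      E[OF \<open>norm (b + c - a - b) = d\<close>] E[OF \<open>norm (b + c - a - c) = d\<close>]
  proof eventually_elim
    case (elim f)
    moreover have "complex_of_real (d^2) \<noteq> 0"
      using enforced_distance_pos[OF d] by simp
    ultimately show ?case
      using phi2_two_circles[of "f a" "f b" _ "f c" "f (b + c - a)"] phi2_rhombus[of "f a" "f b" "f c"]
      by auto
  qed
qed

text \<open>The Moser spindle: turning the rhombus around \<open>a\<close> by the angle with cosine \<open>5/6\<close> moves the
  far vertex by exactly \<open>d\<close>.\<close>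

lemma eventually_rhombus:
  assumes d: "enforced_distance d"
    and abc: "norm (a - b) = d" "norm (a - c) = d" "norm (b - c) = d"
  shows "\<forall>\<^sub>F f in udp_filter.
    f (b + c - a) = f b + f c - f a \<and> phi2 (f a) (f (b + c - a)) = 3 * complex_of_real (d^2)"
proof -
  define R where "R = rot_scale (5/6) (sqrt 11 / 6)"
  define b' c' where "b' = a + R (b - a)" and "c' = a + R (c - a)"
  define e e' where "e = b + c - a" and "e' = b' + c' - a"
  have R: "norm u = norm v" if "u = R v" for u v
    using norm_eq_rot_scale[of u "5/6" "sqrt 11 / 6" v 1] that
    by (simp add: R_def power_divide)
  have "norm (a - b') = norm (a - b)"
    by (rule R) (simp add: vec2_eq_iff b'_def R_def field_simps)
  moreover have "norm (a - c') = norm (a - c)"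
    by (rule R) (simp add: vec2_eq_iff c'_def R_def field_simps)
  moreover have "norm (b' - c') = norm (b - c)"
    by (rule R) (simp add: vec2_eq_iff b'_def c'_def R_def field_simps)
  ultimately have abc': "norm (a - b') = d" "norm (a - c') = d" "norm (b' - c') = d"
    using abc by auto
  have ee': "norm (e - e') = d"
  proof -
    \<comment> \<open>As \<open>e' - a\<close> is \<open>R (e - a)\<close>, the difference is
      identity minus rotation, of modulus \<open>sqrt (1/3)\<close>; this cancels the
      \<open>sqrt 3\<close> of the long diagonal.\<close>
    have "e - e' = rot_scale (1/6) (- sqrt 11 / 6) (e - a)"
      by (simp add: vec2_eq_iff e_def e'_def b'_def c'_def R_def field_simps)
    then have "norm (e - e') = sqrt (1/3) * norm (e - a)"
      by (rule norm_eq_rot_scale) (simp_all add: power_divide)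
    moreover have "norm (e - a) = sqrt 3 * d"
    proof (rule power2_eq_imp_eq)
      have "(norm (u + v))^2 = 2 * (norm u)^2 + 2 * (norm v)^2 - (norm (u - v))^2" for u v :: "real ^ 2"
        unfolding power2_norm_eq_inner by (simp add: inner_add inner_diff inner_commute)
      from this[of "a - b" "a - c"] have "(norm (a - b + (a - c)))^2 = 3 * d^2"
        using abc by (simp add: norm_minus_commute)
      moreover have "e - a = - (a - b + (a - c))"
        by (simp add: e_def)
      ultimately show "(norm (e - a))^2 = (sqrt 3 * d)^2"
        by (simp only: norm_minus_cancel power_mult_distrib) simp
    qed (use enforced_distance_pos[OF d] in simp_all)
    ultimately show ?thesis
      by (simp add: real_sqrt_divide)
  qed
  show ?thesis
    using eventually_rhombus_cases[OF d abc] eventually_rhombus_cases[OF d abc']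
      enforced_distanceD[OF d ee']
    unfolding e_def[symmetric] e'_def[symmetric]
  proof eventually_elim
    case (elim f)
    have "complex_of_real (d^2) \<noteq> 0"
      using enforced_distance_pos[OF d] by simp
    \<comment> \<open>If \<open>f e = f a\<close>, the two cases for \<open>e'\<close> would make
      \<open>phi2 (f e) (f e')\<close> equal to 0 or 3 \<open>d^2\<close>, never
      \<open>d^2\<close>.\<close>
    then have "f e \<noteq> f a"
      using elim(2,3) by (auto simp: phi2_def)
    then show ?case
      using elim(1) by blast
  qed
qed

subsection \<open>New distances from old ones\<close>

lemma enforced_distance_sqrt3:
  assumes d: "enforced_distance d"
  shows "enforced_distance (sqrt 3 * d)"
  unfolding enforced_distance_def
proof (intro conjI allI impI)
  fix x y :: "real ^ 2"
  assume xy: "norm (x - y) = sqrt 3 * d"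
  \<comment> \<open>The short-diagonal vertices of the rhombus with long diagonal \<open>x\<close>,
    \<open>y\<close>: directions at 30 degrees on either side, scaled by
    \<open>sqrt (1/3)\<close>.\<close>
  define b c where "b = x + rot_scale (1/2) (sqrt 3 / 6) (y - x)"
    and "c = x + rot_scale (1/2) (- sqrt 3 / 6) (y - x)"
  have *: "norm u = d" if "norm u = sqrt (1/3) * norm (x - y)" for u :: "real ^ 2"
    using that xy by (simp add: real_sqrt_divide)
  have "norm (x - b) = sqrt (1/3) * norm (x - y)"
    by (rule norm_eq_rot_scale[of _ "1/2" "sqrt 3 / 6"])
      (simp_all add: vec2_eq_iff b_def field_simps)
  moreover have "norm (x - c) = sqrt (1/3) * norm (x - y)"
    by (rule norm_eq_rot_scale[of _ "1/2" "- sqrt 3 / 6"])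
      (simp_all add: vec2_eq_iff c_def field_simps)
  moreover have "norm (b - c) = sqrt (1/3) * norm (x - y)"
    by (rule norm_eq_rot_scale[of _ 0 "- sqrt 3 / 3"])
      (simp_all add: vec2_eq_iff b_def c_def field_simps)
  ultimately have "\<forall>\<^sub>F f in udp_filter.
    f (b + c - x) = f b + f c - f x \<and> phi2 (f x) (f (b + c - x)) = 3 * complex_of_real (d^2)"
    by (intro eventually_rhombus[OF d] *)
  moreover have "b + c - x = y"
    by (simp add: vec2_eq_iff b_def c_def field_simps)
  ultimately show "\<forall>\<^sub>F f in udp_filter. phi2 (f x) (f y) = complex_of_real ((sqrt 3 * d)^2)"
    by (auto simp: power_mult_distrib elim: eventually_mono)
qed (use enforced_distance_pos[OF d] in simp)

text \<open>Two rhombi sharing the triangle \<open>b\<close>, \<open>c\<close>,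
  \<open>b + c - a\<close> lead from \<open>a\<close> to \<open>2 *\<^sub>R b - a\<close>; the
  auxiliary \<open>f c\<close> cancels.\<close>

lemma eventually_double:
  assumes d: "enforced_distance d" and ab: "norm (a - b) = d"
  shows "\<forall>\<^sub>F f in udp_filter. f (2 *\<^sub>R b - a) = 2 *\<^sub>R f b - f a"
proof -
  define c where "c = a + rot_scale (1/2) (sqrt 3 / 2) (b - a)"
  have "norm (a - c) = 1 * norm (a - b)"
    by (rule norm_eq_rot_scale[of _ "1/2" "sqrt 3 / 2"])
      (simp_all add: vec2_eq_iff c_def field_simps)
  moreover have "norm (b - c) = 1 * norm (a - b)"
    by (rule norm_eq_rot_scale[of _ "-1/2" "sqrt 3 / 2"])
      (simp_all add: vec2_eq_iff c_def field_simps)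
  ultimately have ac: "norm (a - c) = d" and bc: "norm (b - c) = d"
    using ab by simp_all
  have 1: "norm (c - b) = d" "norm (c - (b + c - a)) = d" "norm (b - (b + c - a)) = d"
    using ab ac bc by (simp_all add: norm_minus_commute)
  have 2: "b + (b + c - a) - c = 2 *\<^sub>R b - a"
    by (simp add: scaleR_2)
  show ?thesis
    using eventually_rhombus[OF d ab ac bc] eventually_rhombus[OF d 1]
    unfolding 2 by eventually_elim (simp add: scaleR_2)
qed

lemma eventually_triple:
  assumes d: "enforced_distance d" and ab: "norm (a - b) = d"
  shows "\<forall>\<^sub>F f in udp_filter. f (3 *\<^sub>R b - 2 *\<^sub>R a) = 3 *\<^sub>R f b - 2 *\<^sub>R f a"
proof -
  have "norm (b - (2 *\<^sub>R b - a)) = d"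
    using ab by (simp add: scaleR_2 norm_minus_commute)
  moreover have "2 *\<^sub>R (2 *\<^sub>R b - a) - b = 3 *\<^sub>R b - 2 *\<^sub>R a"
    by (simp add: vec2_eq_iff)
  ultimately have "\<forall>\<^sub>F f in udp_filter. f (3 *\<^sub>R b - 2 *\<^sub>R a) = 2 *\<^sub>R f (2 *\<^sub>R b - a) - f b"
    using eventually_double[OF d, of b "2 *\<^sub>R b - a"] by simp
  then show ?thesis
    using eventually_double[OF d ab]
    by eventually_elim (simp add: vec2_eq_iff scaleR_conv_of_real)
qed

lemma enforced_distance_3:
  assumes d: "enforced_distance d"
  shows "enforced_distance (3 * d)"
  unfolding enforced_distance_def
proof (intro conjI allI impI)
  fix x y :: "real ^ 2"
  assume xy: "norm (x - y) = 3 * d"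
  define b where "b = x + rot_scale (1/3) 0 (y - x)"
  have "norm (x - b) = (1/3) * norm (x - y)"
    by (rule norm_eq_rot_scale[of _ "1/3" 0])
      (simp_all add: vec2_eq_iff b_def field_simps)
  then have xb: "norm (x - b) = d"
    using xy by simp
  have y: "3 *\<^sub>R b - 2 *\<^sub>R x = y"
    by (simp add: vec2_eq_iff b_def field_simps)
  show "\<forall>\<^sub>F f in udp_filter. phi2 (f x) (f y) = complex_of_real ((3 * d)^2)"
    using eventually_triple[OF d xb] enforced_distanceD[OF d xb] unfolding y
  proof eventually_elim
    case (elim f)
    have "phi2 (f x) (3 *\<^sub>R f b - 2 *\<^sub>R f x) = 9 * phi2 (f x) (f b)"
      unfolding phi2_def by (simp add: scaleR_conv_of_real power2_eq_square algebra_simps)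
    then show ?case
      using elim by (simp add: power_mult_distrib)
  qed
qed (use enforced_distance_pos[OF d] in simp)

lemma enforced_distance_sqrt8:
  assumes d: "enforced_distance d"
  shows "enforced_distance (sqrt 8 * d)"
  unfolding enforced_distance_def
proof (intro conjI allI impI)
  fix x y :: "real ^ 2"
  assume xy: "norm (x - y) = sqrt 8 * d"
  \<comment> \<open>\<open>y\<close> becomes the midpoint of a base \<open>b\<close>,
    \<open>c\<close> of length 2 \<open>d\<close> perpendicular to \<open>x - y\<close>; the legs
    are 3 \<open>d\<close> since 8 + 1 = 9.\<close>
  define b where "b = y + rot_scale 0 (sqrt 8 / 8) (y - x)"
  define c where "c = 2 *\<^sub>R y - b"
  have "norm (b - y) = sqrt (1/8) * norm (x - y)"
    by (rule norm_eq_rot_scale[of _ 0 "- sqrt 8 / 8"])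
      (simp_all add: vec2_eq_iff b_def field_simps)
  then have bm: "norm (b - y) = d"
    using xy by (simp add: real_sqrt_divide)
  have "norm (x - b) = sqrt (9/8) * norm (x - y)"
    by (rule norm_eq_rot_scale[of _ 1 "sqrt 8 / 8"])
      (simp_all add: vec2_eq_iff b_def field_simps)
  then have xb: "norm (x - b) = 3 * d"
    using xy by (simp add: real_sqrt_divide)
  have "norm (x - c) = sqrt (9/8) * norm (x - y)"
    by (rule norm_eq_rot_scale[of _ 1 "- sqrt 8 / 8"])
      (simp_all add: vec2_eq_iff b_def c_def field_simps)
  then have xc: "norm (x - c) = 3 * d"
    using xy by (simp add: real_sqrt_divide)
  note d3 = enforced_distance_3[OF d]
  show "\<forall>\<^sub>F f in udp_filter. phi2 (f x) (f y) = complex_of_real ((sqrt 8 * d)^2)"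
    using eventually_double[OF d bm] enforced_distanceD[OF d bm]
      enforced_distanceD[OF d3 xb] enforced_distanceD[OF d3 xc]
    unfolding c_def[symmetric]
  proof eventually_elim
    case (elim f)
    have "2 * phi2 (f x) (f y) = phi2 (f x) (f b) + phi2 (f x) (2 *\<^sub>R f y - f b) - 2 * phi2 (f b) (f y)"
      unfolding phi2_def by (simp add: scaleR_conv_of_real power2_eq_square algebra_simps)
    then show ?case
      using elim by (simp add: power_mult_distrib)
  qed
qed (use enforced_distance_pos[OF d] in simp)

lemma enforced_distance_sqrt8_third:
  assumes d: "enforced_distance d"
  shows "enforced_distance (sqrt 8 / 3 * d)"
  unfolding enforced_distance_def
proof (intro conjI allI impI)
  fix x y :: "real ^ 2"
  assume xy: "norm (x - y) = sqrt 8 / 3 * d"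
  \<comment> \<open>Apex of an isosceles triangle on \<open>x\<close>, \<open>y\<close> with legs
    \<open>d\<close>: the squared ratio of leg to base is 9/8 = 1/4 + 7/8.\<close>
  define a where "a = x + rot_scale (1/2) (sqrt (7/8)) (y - x)"
  have "norm (a - x) = sqrt (9/8) * norm (x - y)"
    by (rule norm_eq_rot_scale[of _ "-1/2" "- sqrt (7/8)"])
      (simp_all add: vec2_eq_iff a_def power_divide algebra_simps)
  then have ax: "norm (a - x) = d"
    using xy by (simp add: real_sqrt_divide)
  have "norm (a - y) = sqrt (9/8) * norm (x - y)"
    by (rule norm_eq_rot_scale[of _ "1/2" "- sqrt (7/8)"])
      (simp_all add: vec2_eq_iff a_def power_divide algebra_simps)
  then have ay: "norm (a - y) = d"
    using xy by (simp add: real_sqrt_divide)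
  \<comment> \<open>The images of \<open>x\<close> and \<open>y\<close> under the homothety with
    centre \<open>a\<close> and ratio 3, that is, the far ends of the two rods.\<close>
  define p q where "p = 3 *\<^sub>R x - 2 *\<^sub>R a" and "q = 3 *\<^sub>R y - 2 *\<^sub>R a"
  have "norm (p - q) = 3 * norm (x - y)"
    by (rule norm_eq_rot_scale[of _ 3 0]) (simp_all add: vec2_eq_iff p_def q_def)
  then have pq: "norm (p - q) = sqrt 8 * d"
    using xy by simp
  show "\<forall>\<^sub>F f in udp_filter. phi2 (f x) (f y) = complex_of_real ((sqrt 8 / 3 * d)^2)"
    using eventually_triple[OF d ax] eventually_triple[OF d ay]
      enforced_distanceD[OF enforced_distance_sqrt8[OF d] pq]
    unfolding p_def[symmetric] q_def[symmetric]
  proof eventually_elim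
    case (elim f)
    have "phi2 (3 *\<^sub>R f x - 2 *\<^sub>R f a) (3 *\<^sub>R f y - 2 *\<^sub>R f a) = 9 * phi2 (f x) (f y)"
      unfolding phi2_def by (simp add: scaleR_conv_of_real power2_eq_square algebra_simps)
    then have "9 * phi2 (f x) (f y) = complex_of_real ((sqrt 8 * d)^2)"
      using elim by simp
    then show ?case
      by (simp add: power_mult_distrib power_divide mult.commute)
  qed
qed (use enforced_distance_pos[OF d] in simp)

lemma enforced_distance_products:
  "enforced_distance ((2 * sqrt 2 / 3) ^ k * sqrt 3 ^ l)"
proof -
  have sqrt8: "sqrt 8 = 2 * sqrt 2"
    using real_sqrt_mult[of 4 2] by simp
  have "enforced_distance (sqrt 3 ^ l)"
    by (induction l) (simp_all add: enforced_distance_1 enforced_distance_sqrt3)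
  then show ?thesis
    by (induction k) (use enforced_distance_sqrt8_third in \<open>auto simp: sqrt8 mult.assoc\<close>)
qed

theorem theorem1:
  fixes x y :: "real ^ 2"
  assumes "\<exists>k l :: nat. norm (x - y) = (2 * sqrt 2 / 3) ^ k * sqrt 3 ^ l"
  shows "\<exists>S :: (real ^ 2) set. finite S \<and> {x, y} \<subseteq> S \<and>
           (\<forall>f :: real ^ 2 \<Rightarrow> complex ^ 2. unit_distance_preserving_on S f \<longrightarrow>
              phi2 (f x) (f y) = complex_of_real ((norm (x - y))^2))"
proof -
  have "enforced_distance (norm (x - y))"
    using assms enforced_distance_products by metis
  then obtain S where "finite S" and S: "\<forall>f. unit_distance_preserving_on S f \<longrightarrow>
      phi2 (f x) (f y) = complex_of_real ((norm (x - y))^2)"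
    using enforced_distanceD[OF _ refl] unfolding eventually_udp_filter by metis
  \<comment> \<open>The enforcing set may miss \<open>x\<close> or \<open>y\<close>; adding them
    only strengthens the condition on \<open>f\<close>.\<close>
  moreover have "unit_distance_preserving_on S f" if "unit_distance_preserving_on (S \<union> {x, y}) f" for f
    using that by (rule unit_distance_preserving_on_mono[rotated]) blast
  ultimately show ?thesis
    by (intro exI[of _ "S \<union> {x, y}"]) simp
qed

end
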